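(* For every integer $n\ge 0$, the following identity of polynomials in $x$ and $y$ holds: $$\sum_{m=0}^n\frac{(-x)^{n-m}}{(n-m)!}S_m(x,y)=\frac1{n!}\sum_{k=0}^{\lfloor (n-1)/2\rfloor}\binom{n}{k}\binom{n+y-k}{n-2k-1}(n-k)!\,(n-k-1)!\,x^{k+1},$$ where $$S_m(x,y)=\frac1{m!}\sum_{k=0}^{m-1}\binom{m}{k}\binom{m+y}{m-k-1}(m-k)!\,(m-k-1)!\,x^{k+1}.$$
   Context: Here $x,y$ are indeterminates over $\mathbb{Q}$, and for a polynomial $u$ and an integer $j\ge0$, $\binom{u}{j}=u(u-1)\cdots(u-j+1)/j!$. Empty sums (upper limit $-1$) are $0$; in particular $S_0(x,y)=0$. *)

theory Defs
  imports "HOL-Computational_Algebra.Polynomial"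
begin

text \<open>
  The ring of polynomials in two indeterminates over the rationals is rendered as
  \<open>rat poly poly\<close>: the outer indeterminate is \<open>x\<close>, the inner one is \<open>y\<close>.
\<close>

type_synonym qxy = "rat poly poly"

definition X :: qxy where
  "X = [:0, 1:]"

definition Y :: qxy where
  "Y = [:[:0, 1:]:]"

definition Const :: "rat \<Rightarrow> qxy" where
  "Const c = [:[:c:]:]"

text \<open>
  The library's \<open>gchoose\<close> is constrained to fields of characteristic 0,
  so the binomial coefficient of a polynomial is defined here.
\<close>

definition binom :: "qxy \<Rightarrow> nat \<Rightarrow> qxy" where
  "binom u j = Const (1 / fact j) * (\<Prod>i<j. u - of_nat i)"

definition S :: "nat \<Rightarrow> qxy" where
  "S m = Const (1 / fact m) *
     (\<Sum>k<m. of_nat (m choose k) * binom (of_nat m + Y) (m - k - 1)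
        * fact (m - k) * fact (m - k - 1) * X ^ (k + 1))"

end

theory Submission
  imports Defs
begin

text \<open>
  Put \<open>d = n - m\<close> on the left-hand side and compare coefficients of \<open>x\<close> to the power \<open>k + 1\<close>.
  The summand of \<open>S m\<close> that contributes has index \<open>j = k - d\<close>, so \<open>m - j = n - k\<close> does not depend
  on \<open>d\<close>. Up to the factor \<open>(n - k - 1)! / k!\<close>, what remains is the \<open>k\<close>-th backward difference of
  the binomial coefficient of \<open>n + y\<close> over \<open>n - k - 1\<close>, which Pascal's rule evaluates.
\<close>

lemma Const_mult: "Const (a * b) = Const a * Const b"
  by (simp add: Const_def)

lemma Const_of_nat: "Const (of_nat n) = of_nat n"
  by (simp add: Const_def of_nat_poly)

lemma Const_fact: "Const (fact n) = fact n"
  by (metis Const_of_nat of_nat_fact)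

text \<open>The factorials of \<open>m\<close> and \<open>m - j\<close> cancel. Read forwards this
  simplifies a summand of \<open>S m\<close>; read backwards it restores the factors of the
  right-hand side at the end.\<close>

lemma Const_inverse_fact_binomial:
  assumes "j \<le> m"
  shows "Const (1 / fact m) * of_nat (m choose j) * fact (m - j) = Const (1 / fact j)"
proof -
  have "Const (1 / fact m) * of_nat (m choose j) * fact (m - j)
      = Const (1 / fact m * of_nat (m choose j) * fact (m - j))"
    by (simp only: Const_mult Const_of_nat Const_fact)
  also have "1 / fact m * of_nat (m choose j) * fact (m - j) = (1 / fact j :: rat)"
    using assms by (simp add: binomial_fact)
  finally show ?thesis .
qed

text \<open>Turns the \<open>1 / fact d\<close> outside \<open>S (n - d)\<close> and the
  \<open>1 / fact (k - d)\<close> left over inside into the binomial weight of a \<open>k\<close>-th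
  difference.\<close>

lemma Const_fact_binomial:
  assumes "d \<le> k"
  shows "Const (1 / fact d) * Const (1 / fact (k - d)) = Const (1 / fact k) * of_nat (k choose d)"
proof -
  have "1 / fact d * (1 / fact (k - d)) = (1 / fact k * of_nat (k choose d) :: rat)"
    using assms by (simp add: binomial_fact)
  then show ?thesis
    by (metis Const_mult Const_of_nat)
qed

lemma binom_0: "binom u 0 = 1"
  by (simp add: binom_def Const_def one_pCons)

text \<open>Pascal's rule for a polynomial upper argument. Both falling products contain the
  \<open>q\<close> factors \<open>?P\<close>; the remaining factors differ by
  \<open>u - (u - 1 - q) = q + 1\<close>, which reduces \<open>1 / fact (Suc q)\<close> to
  \<open>1 / fact q\<close>.\<close>

lemma binom_Suc_diff: "binom u (Suc q) - binom (u - 1) (Suc q) = binom (u - 1) q"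
proof -
  let ?P = "\<Prod>i<q. u - 1 - of_nat i"
  have "(\<Prod>i<Suc q. u - of_nat i) = u * ?P"
    by (subst prod.lessThan_Suc_shift) (simp add: algebra_simps)
  moreover have "(\<Prod>i<Suc q. u - 1 - of_nat i) = (u - 1 - of_nat q) * ?P"
    by (simp add: mult.commute)
  ultimately have "binom u (Suc q) - binom (u - 1) (Suc q)
      = Const (1 / fact (Suc q)) * of_nat (Suc q) * ?P"
    unfolding binom_def by (simp add: algebra_simps)
  also have "Const (1 / fact (Suc q)) * of_nat (Suc q) = Const (1 / fact q)"
    using Const_inverse_fact_binomial[of q "Suc q"] by simp
  finally show ?thesis
    by (simp add: binom_def)
qed

text \<open>A difference of order \<open>k + 1\<close> is a \<open>k\<close>-th difference of first
  differences: split \<open>Suc k choose Suc d\<close> by Pascal's rule and shift the index in one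
  half.\<close>

lemma alternating_binomial_sum_Suc:
  fixes g :: "nat \<Rightarrow> 'a::comm_ring_1"
  shows "(\<Sum>d\<le>Suc k. (-1) ^ d * of_nat (Suc k choose d) * g d)
    = (\<Sum>d\<le>k. (-1) ^ d * of_nat (k choose d) * (g d - g (Suc d)))"
proof -
  have "(\<Sum>d\<le>Suc k. (-1) ^ d * of_nat (Suc k choose d) * g d)
      = g 0 - (\<Sum>d\<le>k. (-1) ^ d * of_nat (Suc k choose Suc d) * g (Suc d))"
    by (subst sum.atMost_Suc_shift) (simp add: sum_negf)
  also have "\<dots> = g 0 - (\<Sum>d\<le>k. (-1) ^ d * of_nat (k choose Suc d) * g (Suc d))
      - (\<Sum>d\<le>k. (-1) ^ d * of_nat (k choose d) * g (Suc d))"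
    by (simp add: algebra_simps sum.distrib)
  also have "g 0 - (\<Sum>d\<le>k. (-1) ^ d * of_nat (k choose Suc d) * g (Suc d))
      = (\<Sum>d\<le>Suc k. (-1) ^ d * of_nat (k choose d) * g d)"
    by (subst sum.atMost_Suc_shift) (simp add: sum_negf)
  \<comment> \<open>The top term \<open>d = Suc k\<close> vanishes because
    \<open>k choose Suc k = 0\<close>.\<close>
  also have "\<dots> = (\<Sum>d\<le>k. (-1) ^ d * of_nat (k choose d) * g d)"
    by (simp add: binomial_eq_0)
  finally show ?thesis
    by (simp add: algebra_simps sum_subtractf)
qed

text \<open>Each difference lowers both \<open>u\<close> and \<open>q\<close> by one, so the
  induction must leave \<open>u\<close> and \<open>q\<close> arbitrary. Once the lower index reaches
  0 the polynomial is the constant 1, and any further difference is 0.\<close>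

lemma binom_backward_difference:
  "(\<Sum>d\<le>k. (-1) ^ d * of_nat (k choose d) * binom (u - of_nat d) q)
    = (if k \<le> q then binom (u - of_nat k) (q - k) else 0)"
proof (induction k arbitrary: u q)
  case 0
  then show ?case by simp
next
  case (Suc k)
  show ?case
  proof (cases q)
    case 0
    then show ?thesis
      by (simp only: alternating_binomial_sum_Suc) (simp add: binom_0)
  next
    case (Suc r)
    have "binom (u - of_nat d) q - binom (u - of_nat (Suc d)) q = binom (u - 1 - of_nat d) r" for d
      using binom_Suc_diff[of "u - of_nat d" r] Suc by (simp add: algebra_simps)
    then show ?thesis
      using Suc.IH[of "u - 1" r] Suc
      by (simp only: alternating_binomial_sum_Suc) (simp add: algebra_simps)
  qed
qed

theorem lemma3p2:
  fixes n :: nat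
  shows "(\<Sum>m=0..n. Const (1 / fact (n - m)) * (- X) ^ (n - m) * S m) =
    Const (1 / fact n) *
      (\<Sum>k \<in> {k::nat. int k \<le> \<lfloor>(of_nat n - 1) / 2 :: rat\<rfloor>}.
        of_nat (n choose k) * binom (of_nat n + Y - of_nat k) (n - 2 * k - 1)
          * fact (n - k) * fact (n - k - 1) * X ^ (k + 1))"
proof -
  let ?w = "\<lambda>k. Const (1 / fact k) * fact (n - k - 1) * X ^ (k + 1)"
  let ?t = "\<lambda>k d. ?w k * ((-1) ^ d * of_nat (k choose d)
      * binom (of_nat n + Y - of_nat d) (n - k - 1))"
  let ?s = "\<lambda>m j. Const (1 / fact (n - m)) * (- X) ^ (n - m) * (Const (1 / fact m) *
      (of_nat (m choose j) * binom (of_nat m + Y) (m - j - 1)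
        * fact (m - j) * fact (m - j - 1) * X ^ (j + 1)))"
  \<comment> \<open>The bound means \<open>2 * k + 1 \<le> n\<close>; this form matches the
    condition \<open>k \<le> q\<close> of the difference formula at \<open>q = n - k - 1\<close>.
    Subtraction truncates, so \<open>k < n\<close> is what excludes \<open>k = 0\<close> when
    \<open>n = 0\<close>.\<close>
  have range: "{k::nat. int k \<le> \<lfloor>(of_nat n - 1) / 2 :: rat\<rfloor>} = {k. k < n \<and> k \<le> n - k - 1}"
  proof -
    have "int k \<le> \<lfloor>(of_nat n - 1) / 2 :: rat\<rfloor> \<longleftrightarrow> k < n \<and> k \<le> n - k - 1" for k
    proof -
      have "int k \<le> \<lfloor>(of_nat n - 1) / 2 :: rat\<rfloor> \<longleftrightarrow> of_nat (2 * k + 1) \<le> (of_nat n :: rat)"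
        by (simp add: le_floor_iff field_simps)
      also have "\<dots> \<longleftrightarrow> 2 * k + 1 \<le> n"
        by (simp only: of_nat_le_iff)
      finally show ?thesis by auto
    qed
    then show ?thesis by blast
  qed
  have summand: "?s (n - d) (k - d) = ?t k d" if "k < n" "d \<le> k" for k d
  proof -
    have "n - (n - d) = d" "n - d - (k - d) = n - k" "of_nat (n - d) + Y = of_nat n + Y - of_nat d"
      using that by (auto simp: of_nat_diff)
    then have "?s (n - d) (k - d)
        = Const (1 / fact d) * (- X) ^ d
          * (Const (1 / fact (n - d)) * of_nat ((n - d) choose (k - d)) * fact (n - d - (k - d)))
          * binom (of_nat n + Y - of_nat d) (n - k - 1) * fact (n - k - 1) * X ^ (k - d + 1)"
      by (simp only: ac_simps)
    also have "\<dots> = (Const (1 / fact d) * Const (1 / fact (k - d))) * (- X) ^ d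
          * binom (of_nat n + Y - of_nat d) (n - k - 1) * fact (n - k - 1) * X ^ (k - d + 1)"
      using that by (subst Const_inverse_fact_binomial) (auto simp only: ac_simps diff_le_mono less_imp_le)
    also have "\<dots> = Const (1 / fact k) * of_nat (k choose d) * (-1) ^ d
          * binom (of_nat n + Y - of_nat d) (n - k - 1) * fact (n - k - 1) * (X ^ d * X ^ (k - d + 1))"
      by (simp only: Const_fact_binomial[OF that(2)] power_minus[of X] ac_simps)
    also have "X ^ d * X ^ (k - d + 1) = X ^ (k + 1)"
      using that by (simp flip: power_add)
    finally show ?thesis by (simp only: ac_simps)
  qed
  have "(\<Sum>m=0..n. Const (1 / fact (n - m)) * (- X) ^ (n - m) * S m)
      = (\<Sum>m=0..n. \<Sum>j<m. ?s m j)"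
    by (simp only: S_def sum_distrib_left)
  also have "\<dots> = (\<Sum>(m, j)\<in>(SIGMA m:{0..n}. {..<m}). ?s m j)"
    by (rule sum.Sigma) auto
  \<comment> \<open>Collect by the power of \<open>X\<close>: the exponent is
    \<open>(n - m) + (j + 1) = k + 1\<close>. The condition \<open>j < m\<close> becomes
    \<open>k < n\<close>, and \<open>0 \<le> j\<close> becomes \<open>d \<le> k\<close>.\<close>
  also have "\<dots> = (\<Sum>(k, d)\<in>(SIGMA k:{..<n}. {..k}). ?t k d)"
  proof (rule sum.reindex_bij_witness
      [where i = "\<lambda>(k, d). (n - d, k - d)" and j = "\<lambda>(m, j). (n - m + j, n - m)"])
    fix p assume "p \<in> (SIGMA m:{0..n}. {..<m})"
    then obtain m j where p: "p = (m, j)" and mj: "m \<le> n" "j < m" by auto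
    show "(case case p of (m, j) \<Rightarrow> (n - m + j, n - m) of (k, d) \<Rightarrow> ?t k d)
        = (case p of (m, j) \<Rightarrow> ?s m j)"
    proof -
      have "n - m + j < n" using mj by linarith
      from summand[OF this le_add1] show ?thesis
        by (simp only: p prod.case diff_diff_cancel[OF mj(1)] diff_add_inverse)
    qed
  qed auto
  also have "\<dots> = (\<Sum>k<n. \<Sum>d\<le>k. ?t k d)"
    by (rule sum.Sigma [symmetric]) auto
  also have "\<dots> = (\<Sum>k<n. ?w k * (if k \<le> n - k - 1
      then binom (of_nat n + Y - of_nat k) (n - k - 1 - k) else 0))"
    by (simp only: binom_backward_difference flip: sum_distrib_left)
  also have "\<dots> = (\<Sum>k\<in>{k. k < n \<and> k \<le> n - k - 1}.
      ?w k * binom (of_nat n + Y - of_nat k) (n - k - 1 - k))"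
    by (rule sum.mono_neutral_cong_right) auto
  \<comment> \<open>Expand \<open>1 / fact k\<close> in \<open>?w k\<close> into
    \<open>1 / fact n\<close> times \<open>n choose k\<close> times
    \<open>fact (n - k)\<close>.\<close>
  also have "\<dots> = (\<Sum>k\<in>{k. k < n \<and> k \<le> n - k - 1}. Const (1 / fact n) *
      (of_nat (n choose k) * binom (of_nat n + Y - of_nat k) (n - 2 * k - 1)
          * fact (n - k) * fact (n - k - 1) * X ^ (k + 1)))"
  proof (rule sum.cong[OF refl])
    fix k assume "k \<in> {k. k < n \<and> k \<le> n - k - 1}"
    then have "k \<le> n" and "n - k - 1 - k = n - 2 * k - 1" by auto
    then show "?w k * binom (of_nat n + Y - of_nat k) (n - k - 1 - k) = Const (1 / fact n) *
      (of_nat (n choose k) * binom (of_nat n + Y - of_nat k) (n - 2 * k - 1)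
          * fact (n - k) * fact (n - k - 1) * X ^ (k + 1))"
      by (simp only: ac_simps flip: Const_inverse_fact_binomial)
  qed
  finally show ?thesis
    by (simp only: range sum_distrib_left)
qed

end
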